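(* Let $n\ge1$, let $\varphi:[0,\infty)\to[0,\infty)$ be a measurable function, and let $(Z_1,\dots,Z_n)\in\mathbb{C}^n$ be a random vector whose density with respect to Lebesgue measure on $\mathbb{C}^n$ is proportional to $\prod_{1\le j<k\le n}|z_j-z_k|^2\cdot\prod_{j=1}^n\varphi(|z_j|)$. Let $$P_n(y)=\frac1n\sum_{j=1}^np_j(y),\qquad p_j(y)=\frac{y^{2j-1}\varphi(y)I(y\ge0)}{\int_0^\infty y^{2j-1}\varphi(y)\,dy},\qquad 1\le j\le n.$$ Then the following hold. (i) For any bounded measurable function $h$ on $\mathbb{C}$, $$\mathrm{E}h(Z_1)=\frac{1}{2\pi}\int_0^\infty\Big(\int_0^{2\pi}h(re^{i\theta})\,d\theta\Big)P_n(r)\,dr.$$ (ii) Let $\Theta_1=\arg(Z_1)\in[0,2\pi)$. Then $|Z_1|$ has density $P_n(r)$, $\Theta_1\sim Unif[0,2\pi]$, and the two are independent. Consequently, for any bounded measurable function $g(\theta,r)$, $$\mathrm{E}g(\Theta_1,|Z_1|)=\frac{1}{2\pi}\int_0^\infty\Big(\int_0^{2\pi}g(\theta,r)\,d\theta\Big)P_n(r)\,dr.$$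
   Context: Standing assumption: $0<\int_0^\infty y^{2j-1}\varphi(y)\,dy<\infty$ for each $1\le j\le n$. The argument is such that $Z_1=|Z_1|e^{i\Theta_1}$. $Unif(A)$ is the uniform distribution on $A$ and $I(\cdot)$ is the indicator. *)

theory Defs
  imports "HOL-Probability.Probability"
begin

definition rot_inv_weight :: "nat \<Rightarrow> (real \<Rightarrow> real) \<Rightarrow> (nat \<Rightarrow> complex) \<Rightarrow> real" where
  "rot_inv_weight n \<phi> z =
     (\<Prod>(j, k)\<in>{(j, k). 1 \<le> j \<and> j < k \<and> k \<le> n}. (cmod (z j - z k))\<^sup>2) *
     (\<Prod>j=1..n. \<phi> (cmod (z j)))"

(* Extended-valued, so that both positivity and finiteness are genuine conditions. *)
definition radial_moment :: "(real \<Rightarrow> real) \<Rightarrow> nat \<Rightarrow> ennreal" where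
  "radial_moment \<phi> j = (\<integral>\<^sup>+ y\<in>{0..}. ennreal (y ^ (2 * j - 1) * \<phi> y) \<partial>lborel)"

definition radial_density :: "(real \<Rightarrow> real) \<Rightarrow> nat \<Rightarrow> real \<Rightarrow> real" where
  "radial_density \<phi> j y =
     y ^ (2 * j - 1) * \<phi> y * indicator {0..} y / enn2real (radial_moment \<phi> j)"

definition mean_radial_density :: "nat \<Rightarrow> (real \<Rightarrow> real) \<Rightarrow> real \<Rightarrow> real" where
  "mean_radial_density n \<phi> y = 1 / real n * (\<Sum>j=1..n. radial_density \<phi> j y)"

end

theory Submission imports Defs "Jordan_Normal_Form.Determinant"
begin

text \<open>
  Expand the Vandermonde product as a signed sum over permutations, so that its squared modulus is
  a double sum over pairs of permutations of products of one-variable monomials in \<open>z\<^sub>j\<close> and its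
  conjugate. By rotation invariance of Lebesgue measure, distinct powers of a complex variable are
  orthogonal for the weight \<open>\<phi>(|z|)\<close>; hence if the event only constrains \<open>z\<^sub>1\<close>, all the exponents at
  \<open>j \<ge> 2\<close> must agree, which forces the two permutations to coincide. What remains is rotation
  invariant in \<open>z\<^sub>1\<close>, with each of the \<open>n\<close> radial densities occurring equally often, so polar
  coordinates give the joint law of argument and modulus on rectangles. The normalising constant is
  never computed: it is read off from the total mass.
\<close>

section \<open>The Vandermonde determinant and sums over permutations\<close>

hide_const (open) Determinants.det Module.smult

text \<open>The double sum is signed and complex-valued, so nonnegative integration does not
  suffice: every mixed term needs its own Bochner integrability, and the diagonal moments, the only
  ones controlled by hypothesis, have to dominate it. The coordinate restricted by the event gives
  no orthogonality relation; this does no harm, since a permutation is determined by its values at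
  all points but one. Polar coordinates are built from three ingredients: shears give rotation
  invariance, the area of a disc gives the factor 2 pi r, and averaging over all rotations combines
  the two. Rectangles in argument and modulus determine the joint law because they generate the
  product sigma-algebra and are stable under intersection; the formula for E h(Z_1) is then the case
  g(theta, r) = h(r e^(i theta)). Exponents start at 0 and moments at 1: |z|^(2k) times the Jacobian
  r becomes r^(2(k+1)-1), the integrand of moment k+1.\<close>

definition vandermonde_mat :: "nat \<Rightarrow> (nat \<Rightarrow> 'a) \<Rightarrow> 'a :: comm_ring_1 mat" where
  "vandermonde_mat n x = mat n n (\<lambda>(i, j). x i ^ j)"

lemma vandermonde_mat_carrier [simp]: "vandermonde_mat n x \<in> carrier_mat n n"
  by (simp add: vandermonde_mat_def)

lemma vandermonde_mat_index [simp]: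
  "i < n \<Longrightarrow> j < n \<Longrightarrow> vandermonde_mat n x $$ (i, j) = x i ^ j"
  by (simp add: vandermonde_mat_def)

lemma det_vandermonde_eq_0:
  assumes "i < n" "j < n" "i \<noteq> j" "x i = x j"
  shows "det (vandermonde_mat n x) = 0"
  by (rule det_identical_rows[OF vandermonde_mat_carrier assms(3,1,2)])
     (use assms in \<open>auto simp: vandermonde_mat_def\<close>)

text \<open>Freeing the last node turns the determinant into a polynomial that vanishes at the other
  nodes. When these are distinct, the roots and the top coefficient, which is the smaller
  determinant, fix the polynomial. When two of them coincide, both determinants vanish and the
  induction hypothesis already makes the product zero.\<close>

lemma det_vandermonde:
  fixes x :: "nat \<Rightarrow> 'a :: idom"
  shows "det (vandermonde_mat n x) = (\<Prod>k<n. \<Prod>j<k. x k - x j)"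
proof (induction n)
  case 0
  then show ?case
    by (simp add: vandermonde_mat_def)
next
  case (Suc n)
  show ?case
  proof (cases "inj_on x {..<n}")
    case True
    define c where "c = (\<lambda>j. cofactor (vandermonde_mat (Suc n) x) n j)"
    \<comment> \<open>the determinant as a polynomial in the last node; its roots are the other nodes\<close>
    define p where "p = (\<Sum>j\<le>n. monom (c j) j)"
    define q where "q = smult (c n) (\<Prod>j<n. [:- x j, 1:])"
    \<comment> \<open>Deleting row \<open>n\<close> removes every trace of the last node, so the
      cofactors \<open>c j\<close> are constants with respect to \<open>t\<close>.\<close>
    have delete_upd: "mat_delete (vandermonde_mat (Suc n) (x(n := t))) n j
        = mat_delete (vandermonde_mat (Suc n) x) n j" for t j
      by (rule eq_matI) (auto simp: mat_delete_def vandermonde_mat_def)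
    have poly_p: "poly p t = det (vandermonde_mat (Suc n) (x(n := t)))" for t
    proof -
      have "det (vandermonde_mat (Suc n) (x(n := t))) =
        (\<Sum>j<Suc n. vandermonde_mat (Suc n) (x(n := t)) $$ (n, j) *
           cofactor (vandermonde_mat (Suc n) (x(n := t))) n j)"
        by (rule laplace_expansion_row) auto
      also have "\<dots> = (\<Sum>j<Suc n. t ^ j * c j)"
        by (intro sum.cong) (auto simp: cofactor_def delete_upd c_def)
      also have "\<dots> = poly p t"
        by (simp add: p_def poly_sum poly_monom mult.commute lessThan_Suc_atMost)
      finally show ?thesis ..
    qed
    have "mat_delete (vandermonde_mat (Suc n) x) n n = vandermonde_mat n x"
      by (rule eq_matI) (auto simp: mat_delete_def vandermonde_mat_def)
    then have c_n: "c n = det (vandermonde_mat n x)"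
      by (simp add: c_def cofactor_def flip: mult_2)
    have deg_prod: "degree (\<Prod>j<n. [:- x j, 1:]) = n"
      by (subst degree_prod_eq_sum_degree) auto
    have "lead_coeff (\<Prod>j<n. [:- x j, 1:]) = 1"
      by (simp add: lead_coeff_prod)
    then have coeff_q: "coeff q n = c n"
      by (simp add: q_def deg_prod)
    have coeff_p: "coeff p n = c n"
      by (simp add: p_def coeff_sum)
    \<comment> \<open>Both have degree at most \<open>n\<close> and the same coefficient at
      \<open>n\<close>, so their difference has degree below \<open>n\<close> (or is zero) and yet
      vanishes at \<open>n\<close> distinct nodes.\<close>
    have "p = q"
    proof (rule poly_eqI_degree_lead_coeff[of _ n _ "x ` {..<n}"])
      show "card (x ` {..<n}) \<ge> n"
        using True by (simp add: card_image)
      show "degree p \<le> n"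
        unfolding p_def by (intro degree_sum_le) (auto intro: order_trans[OF degree_monom_le])
      show "degree q \<le> n"
        using deg_prod degree_smult_le[of "c n" "\<Prod>j<n. [:- x j, 1:]"] by (simp add: q_def)
      show "poly p z = poly q z" if "z \<in> x ` {..<n}" for z
      proof -
        obtain i where i: "i < n" "z = x i"
          using \<open>z \<in> x ` {..<n}\<close> by blast
        have "poly p z = 0"
          unfolding poly_p using i by (intro det_vandermonde_eq_0[of i _ n]) auto
        moreover have "poly q z = 0"
          using i by (auto simp: q_def poly_prod)
        ultimately show ?thesis by simp
      qed
    qed (simp add: coeff_p coeff_q)
    have "det (vandermonde_mat (Suc n) x) = poly p (x n)"
      by (simp add: poly_p)
    also have "\<dots> = c n * (\<Prod>j<n. x n - x j)"
      by (simp add: \<open>p = q\<close> q_def poly_prod)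
    finally show ?thesis
      by (simp add: c_n Suc.IH mult.commute)
  next
    case False
    then obtain i j where ij: "i < n" "j < n" "i \<noteq> j" "x i = x j"
      by (auto simp: inj_on_def)
    have "det (vandermonde_mat (Suc n) x) = 0" "det (vandermonde_mat n x) = 0"
      using ij by (auto intro: det_vandermonde_eq_0[of i _ j])
    then show ?thesis
      using Suc.IH by simp
  qed
qed

lemma prod_diff_eq_sum_permutations:
  fixes x :: "nat \<Rightarrow> 'a :: idom"
  shows "(\<Prod>k<n. \<Prod>j<k. x k - x j) =
    (\<Sum>p | p permutes {0..<n}. of_int (sign p) * (\<Prod>i<n. x i ^ p i))"
proof -
  have "(\<Prod>k<n. \<Prod>j<k. x k - x j) = det (vandermonde_mat n x)"
    by (simp add: det_vandermonde)
  also have "\<dots> = (\<Sum>p | p permutes {0..<n}. of_int (sign p) * (\<Prod>i<n. x i ^ p i))"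
    by (subst det_def'[OF vandermonde_mat_carrier])
       (auto intro!: sum.cong prod.cong simp: lessThan_atLeast0 permutes_in_image[THEN iffD2])
  finally show ?thesis .
qed

text \<open>Outside \<open>a\<close> the permutation \<open>inv q \<circ> p\<close> fixes
  everything, and a permutation of a single point is the identity. With \<open>a = 0\<close> this
  compensates for the missing orthogonality relation at the first coordinate.\<close>

lemma permutes_eq_if_eq_except_one:
  assumes "p permutes S" "q permutes S" "\<And>i. i \<in> S - {a} \<Longrightarrow> p i = q i"
  shows "p = q"
proof -
  have "(Hilbert_Choice.inv q \<circ> p) permutes S"
    using assms by (simp add: permutes_compose permutes_inv)
  moreover have "(Hilbert_Choice.inv q \<circ> p) i = i" if "i \<noteq> a" for i
    using that assms by (cases "i \<in> S") (auto simp: permutes_not_in permutes_inverses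
      permutes_inv_eq)
  ultimately have "(Hilbert_Choice.inv q \<circ> p) permutes {a}"
    by (auto simp: permutes_superset permutes_def)
  then have "Hilbert_Choice.inv q \<circ> p = id"
    by simp
  then show "p = q"
    using assms(2) by (metis comp_assoc id_comp comp_id permutes_inv_o(1))
qed

text \<open>Composing with the transposition of \<open>a\<close> and \<open>k\<close> is a bijection
  between the permutations sending \<open>a\<close> to \<open>k\<close> and those fixing
  \<open>a\<close>, so every value is taken equally often. The count stays an unevaluated
  cardinality because the normalisation absorbs it later.\<close>

lemma sum_permutations_apply:
  fixes f :: "'a \<Rightarrow> 'b :: comm_semiring_1"
  assumes "finite S" "a \<in> S"
  shows "(\<Sum>p | p permutes S. f (p a)) = of_nat (card {p. p permutes S \<and> p a = a}) * (\<Sum>k\<in>S. f k)"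
proof -
  have fin: "finite {p. p permutes S}"
    using assms by (simp add: finite_permutations)
  have card: "card {p. p permutes S \<and> p a = k} = card {p. p permutes S \<and> p a = a}" if "k \<in> S" for k
  proof (rule bij_betw_same_card[of "\<lambda>p. Transposition.transpose a k \<circ> p"])
    show "bij_betw (\<lambda>p. Transposition.transpose a k \<circ> p) {p. p permutes S \<and> p a = k} {p. p permutes S \<and> p a = a}"
      by (rule bij_betw_byWitness[where f' = "\<lambda>p. Transposition.transpose a k \<circ> p"])
         (use that assms in \<open>auto simp: permutes_compose permutes_swap_id simp flip: comp_assoc\<close>)
  qed
  have "(\<Sum>p | p permutes S. f (p a)) =
      (\<Sum>k\<in>S. \<Sum>p | p \<in> {p. p permutes S} \<and> p a = k. f (p a))"
    by (rule sum.group[symmetric]) (use assms fin in \<open>auto simp: permutes_in_image\<close>)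
  also have "\<dots> = (\<Sum>k\<in>S. \<Sum>p | p permutes S \<and> p a = k. f k)"
    by (intro sum.cong) auto
  also have "\<dots> = (\<Sum>k\<in>S. of_nat (card {p. p permutes S \<and> p a = a}) * f k)"
    by (intro sum.cong) (auto simp: card)
  finally show ?thesis
    by (simp add: sum_distrib_left)
qed

section \<open>Polar coordinates in the complex plane\<close>

lemma measurable_Complex [measurable (raw)]:
  assumes [measurable]: "f \<in> borel_measurable M" "g \<in> borel_measurable M"
  shows "(\<lambda>x. Complex (f x) (g x)) \<in> borel_measurable M"
  unfolding Complex_eq by measurable

text \<open>Lebesgue measure on the plane is characterised by the volumes of boxes, so comparing
  these identifies it with the image of the product measure; Tonelli does the rest.\<close>

lemma nn_integral_lborel_complex:
  assumes [measurable]: "f \<in> borel_measurable borel"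
  shows "(\<integral>\<^sup>+z. f z \<partial>lborel) = (\<integral>\<^sup>+x. \<integral>\<^sup>+y. f (Complex x y) \<partial>lborel \<partial>lborel)"
proof -
  have "lborel = distr (lborel \<Otimes>\<^sub>M lborel) borel (\<lambda>(x, y). Complex x y)"
  proof (rule lborel_eqI)
    fix l u :: complex
    assume "\<And>b. b \<in> Basis \<Longrightarrow> l \<bullet> b \<le> u \<bullet> b"
    then have le: "Re l \<le> Re u" "Im l \<le> Im u"
      by (force simp: Basis_complex_def inner_complex_def)+
    have "(\<lambda>(x, y). Complex x y) -` box l u = {Re l<..<Re u} \<times> {Im l<..<Im u}"
      by (auto simp: box_def Basis_complex_def inner_complex_def)
    then show "emeasure (distr (lborel \<Otimes>\<^sub>M lborel) borel (\<lambda>(x, y). Complex x y)) (box l u) =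
        ennreal (\<Prod>b\<in>Basis. (u - l) \<bullet> b)"
      using le by (subst emeasure_distr)
        (simp_all add: space_pair_measure lborel.emeasure_pair_measure_Times Basis_complex_def
          inner_complex_def ennreal_mult)
  qed simp
  then have "(\<integral>\<^sup>+z. f z \<partial>lborel) =
      (\<integral>\<^sup>+z. f z \<partial>distr (lborel \<Otimes>\<^sub>M lborel) borel (\<lambda>(x, y). Complex x y))"
    by simp
  also have "\<dots> = (\<integral>\<^sup>+x. f (case x of (x, y) \<Rightarrow> Complex x y) \<partial>(lborel \<Otimes>\<^sub>M lborel))"
    by (rule nn_integral_distr) auto
  also have "\<dots> = (\<integral>\<^sup>+x. \<integral>\<^sup>+y. f (Complex x y) \<partial>lborel \<partial>lborel)"
    by (subst lborel.nn_integral_fst[symmetric]) auto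
  finally show ?thesis .
qed

section \<open>Rotation invariance of planar Lebesgue measure\<close>

lemma nn_integral_lborel_translate:
  fixes f :: "real \<Rightarrow> ennreal"
  assumes "f \<in> borel_measurable borel"
  shows "(\<integral>\<^sup>+x. f (x + c) \<partial>lborel) = (\<integral>\<^sup>+x. f x \<partial>lborel)"
  using nn_integral_real_affine[OF assms, of 1 c] by (simp add: add.commute)

text \<open>For a fixed imaginary part the shear is a translation of the real part, so the real part
  must become the inner variable before translation invariance applies.\<close>

lemma nn_integral_shear_Re:
  assumes [measurable]: "f \<in> borel_measurable borel"
  shows "(\<integral>\<^sup>+z. f (Complex (Re z + a * Im z) (Im z)) \<partial>lborel) = (\<integral>\<^sup>+z. f z \<partial>lborel)"
proof -
  have "(\<integral>\<^sup>+z. f (Complex (Re z + a * Im z) (Im z)) \<partial>lborel) =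
      (\<integral>\<^sup>+x. \<integral>\<^sup>+y. f (Complex (x + a * y) y) \<partial>lborel \<partial>lborel)"
    by (subst nn_integral_lborel_complex) auto
  also have "\<dots> = (\<integral>\<^sup>+y. \<integral>\<^sup>+x. f (Complex (x + a * y) y) \<partial>lborel \<partial>lborel)"
    by (rule lborel_pair.Fubini'[symmetric]) measurable
  also have "\<dots> = (\<integral>\<^sup>+y. \<integral>\<^sup>+x. f (Complex x y) \<partial>lborel \<partial>lborel)"
    by (intro nn_integral_cong nn_integral_lborel_translate[where f = "\<lambda>x. f (Complex x _)"]) measurable
  also have "\<dots> = (\<integral>\<^sup>+x. \<integral>\<^sup>+y. f (Complex x y) \<partial>lborel \<partial>lborel)"
    by (rule lborel_pair.Fubini') measurable
  finally show ?thesis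
    by (simp add: nn_integral_lborel_complex)
qed

lemma nn_integral_shear_Im:
  assumes [measurable]: "f \<in> borel_measurable borel"
  shows "(\<integral>\<^sup>+z. f (Complex (Re z) (Im z + a * Re z)) \<partial>lborel) = (\<integral>\<^sup>+z. f z \<partial>lborel)"
proof -
  have "(\<integral>\<^sup>+z. f (Complex (Re z) (Im z + a * Re z)) \<partial>lborel) =
      (\<integral>\<^sup>+x. \<integral>\<^sup>+y. f (Complex x (y + a * x)) \<partial>lborel \<partial>lborel)"
    by (subst nn_integral_lborel_complex) auto
  also have "\<dots> = (\<integral>\<^sup>+x. \<integral>\<^sup>+y. f (Complex x y) \<partial>lborel \<partial>lborel)"
    by (intro nn_integral_cong nn_integral_lborel_translate[where f = "\<lambda>y. f (Complex _ y)"]) measurable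
  finally show ?thesis
    by (simp add: nn_integral_lborel_complex)
qed

text \<open>A rotation by an angle that is no multiple of \<open>\<pi>\<close> is a composition of three shears.\<close>

lemma nn_integral_cis_mult:
  assumes f: "f \<in> borel_measurable borel"
  shows "(\<integral>\<^sup>+z. f (cis \<alpha> * z) \<partial>lborel) = (\<integral>\<^sup>+z. f z \<partial>lborel)"
proof -
  have sin_neq_0: "(\<integral>\<^sup>+z. f (cis \<alpha> * z) \<partial>lborel) = (\<integral>\<^sup>+z. f z \<partial>lborel)"
    if [measurable]: "f \<in> borel_measurable borel" and "sin \<alpha> \<noteq> 0" for f \<alpha>
  proof -
    \<comment> \<open>Multiplying out the matrices of \<open>S\<close>, \<open>T\<close>,
      \<open>S\<close> gives lower left entry \<open>sin \<alpha>\<close> from \<open>T\<close> and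
      diagonal entries \<open>1 + a * sin \<alpha>\<close>; equating the latter with
      \<open>cos \<alpha>\<close> forces this \<open>a\<close>. Fact \<open>2\<close> is what the
      upper right entry requires.\<close>
    define a where "a = (cos \<alpha> - 1) / sin \<alpha>"
    define S where "S = (\<lambda>z. Complex (Re z + a * Im z) (Im z))"
    define T where "T = (\<lambda>z. Complex (Re z) (Im z + sin \<alpha> * Re z))"
    have [measurable]: "S \<in> borel_measurable borel" "T \<in> borel_measurable borel"
      by (simp_all add: S_def T_def)
    have 1: "a * sin \<alpha> = cos \<alpha> - 1"
      using that by (simp add: a_def)
    have "sin \<alpha> * (a * cos \<alpha> + a + sin \<alpha>) = (a * sin \<alpha>) * (cos \<alpha> + 1) + (sin \<alpha>)\<^sup>2"
      by (simp add: algebra_simps power2_eq_square)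
    also have "\<dots> = ((cos \<alpha>)\<^sup>2 + (sin \<alpha>)\<^sup>2) - 1"
      unfolding 1 by (simp add: algebra_simps power2_eq_square del: sin_cos_squared_add sin_cos_squared_add2)
    finally have 2: "a + a * cos \<alpha> = - sin \<alpha>"
      using that by simp
    have 3: "1 + a * sin \<alpha> = cos \<alpha>"
      using 1 by simp
    have "S (T (S z)) = cis \<alpha> * z" for z
    proof (rule complex_eqI)
      have "Re (S (T (S z))) = Re z * (1 + a * sin \<alpha>) + Im z * (a + a * (1 + a * sin \<alpha>))"
        by (simp add: S_def T_def algebra_simps)
      then show "Re (S (T (S z))) = Re (cis \<alpha> * z)"
        unfolding 3 2 by (simp add: algebra_simps)
      have "Im (S (T (S z))) = sin \<alpha> * Re z + Im z * (1 + a * sin \<alpha>)"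
        by (simp add: S_def T_def algebra_simps)
      then show "Im (S (T (S z))) = Im (cis \<alpha> * z)"
        unfolding 3 by (simp add: algebra_simps)
    qed
    then have "(\<integral>\<^sup>+z. f (cis \<alpha> * z) \<partial>lborel) = (\<integral>\<^sup>+z. f (S (T (S z))) \<partial>lborel)"
      by simp
    also have "\<dots> = (\<integral>\<^sup>+z. f (S (T z)) \<partial>lborel)"
      using nn_integral_shear_Re[of "\<lambda>z. f (S (T z))" a] by (simp add: S_def)
    also have "\<dots> = (\<integral>\<^sup>+z. f (S z) \<partial>lborel)"
      using nn_integral_shear_Im[of "\<lambda>z. f (S z)" "sin \<alpha>"] by (simp add: T_def)
    also have "\<dots> = (\<integral>\<^sup>+z. f z \<partial>lborel)"
      using nn_integral_shear_Re[of f a] by (simp add: S_def)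
    finally show ?thesis .
  qed
  show ?thesis
  proof (cases "sin \<alpha> = 0")
    \<comment> \<open>Here the three shears would divide by zero. The rotation is split into those
      by \<open>\<alpha> - pi / 2\<close> and \<open>pi / 2\<close>, both of which have nonzero
      sine.\<close>
    case True
    then have "sin (\<alpha> - pi / 2) \<noteq> 0"
      using sin_zero_abs_cos_one by (force simp: sin_diff)
    then have "(\<integral>\<^sup>+z. f z \<partial>lborel) = (\<integral>\<^sup>+z. f (cis (\<alpha> - pi / 2) * z) \<partial>lborel)"
      using f by (simp add: sin_neq_0)
    also have "\<dots> = (\<integral>\<^sup>+z. f (cis (\<alpha> - pi / 2) * (cis (pi / 2) * z)) \<partial>lborel)"
      using f by (intro sin_neq_0[symmetric]) auto
    also have "\<dots> = (\<integral>\<^sup>+z. f (cis \<alpha> * z) \<partial>lborel)"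
      by (simp only: mult.assoc[symmetric] cis_mult) simp
    finally show ?thesis ..
  qed (use f in \<open>simp add: sin_neq_0\<close>)
qed

text \<open>Stated for the image measure, the invariance passes from nonnegative functions to
  Bochner integrals of complex functions, as the orthogonality argument requires.\<close>

lemma distr_lborel_cis_mult: "distr lborel borel (\<lambda>z. cis \<alpha> * z) = lborel"
proof (rule measure_eqI)
  fix A assume "A \<in> sets (distr lborel borel (\<lambda>z. cis \<alpha> * z))"
  then have [measurable]: "A \<in> sets borel"
    by simp
  have "emeasure (distr lborel borel (\<lambda>z. cis \<alpha> * z)) A = (\<integral>\<^sup>+z. indicator A z \<partial>distr lborel borel (\<lambda>z. cis \<alpha> * z))"
    by simp
  also have "\<dots> = (\<integral>\<^sup>+z. indicator A (cis \<alpha> * z) \<partial>lborel)"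
    by (rule nn_integral_distr) auto
  also have "\<dots> = emeasure lborel A"
    by (subst nn_integral_cis_mult) auto
  finally show "emeasure (distr lborel borel (\<lambda>z. cis \<alpha> * z)) A = emeasure lborel A" .
qed simp

lemma integral_cis_mult:
  fixes f :: "complex \<Rightarrow> 'a :: {banach, second_countable_topology}"
  assumes "f \<in> borel_measurable borel"
  shows "(\<integral>z. f (cis \<alpha> * z) \<partial>lborel) = (\<integral>z. f z \<partial>lborel)"
  using assms by (subst (2) distr_lborel_cis_mult[of \<alpha>, symmetric]) (auto simp: integral_distr)

text \<open>The half-line up to \<open>a\<close> pulls back to a disc of area
  \<open>pi * a\<close>$^2$, whose derivative in the radius is the density; half-lines are an
  intersection-stable generator.\<close>

lemma distr_lborel_cmod:
  "distr lborel borel cmod = density lborel (\<lambda>r. ennreal (2 * pi * r) * indicator {0..} r)"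
proof (rule measure_eqI_generator_eq)
  let ?E = "range (\<lambda>a::real. {..a})"
  let ?N = "density lborel (\<lambda>r. ennreal (2 * pi * r) * indicator {0..} r)"
  have ball: "emeasure (distr lborel borel cmod) {..a} = ennreal (pi * a\<^sup>2)" if "a \<ge> 0" for a
  proof -
    have "cmod -` {..a} = cball 0 a"
      by auto
    then show ?thesis
      using that by (subst emeasure_distr) (auto simp: emeasure_cball unit_ball_vol_2)
  qed
  show "emeasure (distr lborel borel cmod) X = emeasure ?N X" if "X \<in> ?E" for X
  proof -
    obtain a where X: "X = {..a}"
      using \<open>X \<in> ?E\<close> by blast
    show ?thesis
    proof (cases "a \<ge> 0")
      case True
      have "emeasure ?N X = (\<integral>\<^sup>+r. ennreal (2 * pi * r) * indicator {0..a} r \<partial>lborel)"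
        by (auto simp: X emeasure_density intro!: nn_integral_cong split: split_indicator)
      also have "\<dots> = ennreal (pi * a\<^sup>2 - pi * 0\<^sup>2)"
        using True by (intro nn_integral_FTC_Icc)
          (auto intro!: derivative_eq_intros simp: has_real_derivative_iff_has_vector_derivative[symmetric])
      finally show ?thesis
        using True ball by (simp add: X)
    next
      case False
      have "cmod -` {..a} = {}"
        using False by (auto intro: order_trans[OF norm_ge_zero])
      moreover have "emeasure ?N X = 0"
        using False by (subst emeasure_density) (auto simp: X nn_integral_0_iff_AE split: split_indicator)
      ultimately show ?thesis
        by (simp add: X emeasure_distr)
    qed
  qed
  show "Int_stable ?E"
    by (auto simp: Int_stable_def)
  show "?E \<subseteq> Pow UNIV"
    by simp
  show "sets (distr lborel borel cmod) = sigma_sets UNIV ?E" "sets ?N = sigma_sets UNIV ?E"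
    by (simp_all add: borel_eq_atMost)
  show "range (\<lambda>n. {..real n}) \<subseteq> ?E"
    by auto
  show "(\<Union>n. {..real n}) = UNIV"
    by (auto intro: real_arch_simple)
  show "emeasure (distr lborel borel cmod) {..real n} \<noteq> \<infinity>" for n
    by (simp add: ball)
qed

section \<open>Polar coordinates by averaging over rotations\<close>

lemma nn_integral_periodic_shift:
  fixes f :: "real \<Rightarrow> ennreal"
  assumes [measurable]: "f \<in> borel_measurable borel"
    and periodic: "\<And>x. f (x + c) = f x" and a: "0 \<le> a" "a \<le> c"
  shows "(\<integral>\<^sup>+x\<in>{0..c}. f (x + a) \<partial>lborel) = (\<integral>\<^sup>+x\<in>{0..c}. f x \<partial>lborel)"
proof -
  have "(\<integral>\<^sup>+x\<in>{0..c}. f (x + a) \<partial>lborel) = (\<integral>\<^sup>+x. f (x + a) * indicator {a..a + c} (x + a) \<partial>lborel)"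
    by (intro nn_integral_cong) (auto split: split_indicator)
  also have "\<dots> = (\<integral>\<^sup>+x\<in>{a..a + c}. f x \<partial>lborel)"
    by (rule nn_integral_lborel_translate[where f = "\<lambda>x. f x * indicator {a..a + c} x"]) measurable
  \<comment> \<open>The shifted period is cut at \<open>c\<close>; the part beyond \<open>c\<close>
    will be moved back by one period to fill the gap before \<open>a\<close>.\<close>
  also have "\<dots> = (\<integral>\<^sup>+x. f x * indicator {a..c} x + f x * indicator {c<..a + c} x \<partial>lborel)"
    using a by (intro nn_integral_cong) (auto split: split_indicator)
  also have "\<dots> = (\<integral>\<^sup>+x\<in>{a..c}. f x \<partial>lborel) + (\<integral>\<^sup>+x\<in>{c<..a + c}. f x \<partial>lborel)"
    by (rule nn_integral_add) auto
  also have "(\<integral>\<^sup>+x\<in>{c<..a + c}. f x \<partial>lborel) = (\<integral>\<^sup>+x. f (x + c) * indicator {c<..a + c} (x + c) \<partial>lborel)"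
    by (rule nn_integral_lborel_translate[symmetric, where f = "\<lambda>x. f x * indicator {c<..a + c} x"]) measurable
  also have "\<dots> = (\<integral>\<^sup>+x\<in>{0<..a}. f x \<partial>lborel)"
    by (intro nn_integral_cong) (auto simp: periodic split: split_indicator)
  also have "(\<integral>\<^sup>+x\<in>{a..c}. f x \<partial>lborel) + \<dots> =
      (\<integral>\<^sup>+x. f x * indicator {a..c} x + f x * indicator {0<..a} x \<partial>lborel)"
    by (rule nn_integral_add[symmetric]) auto
  also have "\<dots> = (\<integral>\<^sup>+x\<in>{0..c}. f x \<partial>lborel)"
  proof (rule nn_integral_cong_AE)
    \<comment> \<open>The reassembled pieces may overlap at \<open>a\<close> and miss
      \<open>0\<close>, so the equality holds only up to these two points.\<close>
    have "AE x in lborel. x \<noteq> 0 \<and> x \<noteq> a"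
      by (simp add: AE_lborel_singleton)
    then show "AE x in lborel. f x * indicator {a..c} x + f x * indicator {0<..a} x =
        f x * indicator {0..c} x"
      by eventually_elim (use a in \<open>auto split: split_indicator\<close>)
  qed
  finally show ?thesis .
qed

lemma measurable_cis [measurable (raw)]:
  "f \<in> borel_measurable M \<Longrightarrow> (\<lambda>x. cis (f x)) \<in> borel_measurable M"
  by (rule borel_measurable_continuous_on[OF _ , of cis]) (auto intro!: continuous_intros)

text \<open>The integral equals its average over all rotations. After exchanging the integrals, the
  inner average \<open>F\<close> depends only on the modulus, since the argument of \<open>z\<close>
  merely shifts a periodic integrand. The law of the modulus then supplies
  \<open>2 * pi * r\<close>, and the factor \<open>2 * pi\<close> from the averaging
  cancels.\<close>

lemma nn_integral_polar:
  assumes f [measurable]: "f \<in> borel_measurable borel"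
  shows "(\<integral>\<^sup>+z. f z \<partial>lborel) =
    (\<integral>\<^sup>+r\<in>{0..}. ennreal r * (\<integral>\<^sup>+\<theta>\<in>{0..2 * pi}. f (complex_of_real r * cis \<theta>) \<partial>lborel) \<partial>lborel)"
proof -
  define F where "F = (\<lambda>r. \<integral>\<^sup>+\<theta>\<in>{0..2 * pi}. f (complex_of_real r * cis \<theta>) \<partial>lborel)"
  have [measurable]: "F \<in> borel_measurable borel"
    unfolding F_def by measurable
  have F_cmod: "(\<integral>\<^sup>+\<theta>\<in>{0..2 * pi}. f (cis \<theta> * z) \<partial>lborel) = F (cmod z)" for z
  proof -
    have z: "z = complex_of_real (cmod z) * cis (Arg2pi z)"
      using Arg2pi_eq[of z] by (simp add: cis_conv_exp)
    have "(\<integral>\<^sup>+\<theta>\<in>{0..2 * pi}. f (cis \<theta> * z) \<partial>lborel) =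
        (\<integral>\<^sup>+\<theta>\<in>{0..2 * pi}. f (complex_of_real (cmod z) * cis (\<theta> + Arg2pi z)) \<partial>lborel)"
      by (subst z) (simp add: mult_ac flip: cis_mult)
    also have "\<dots> = F (cmod z)"
      unfolding F_def
      by (rule nn_integral_periodic_shift[where f = "\<lambda>\<theta>. f (complex_of_real (cmod z) * cis \<theta>)"])
         (auto simp: Arg2pi_ge_0 less_imp_le[OF Arg2pi_lt_2pi] simp flip: cis_mult)
    finally show ?thesis .
  qed
  have "ennreal (2 * pi) * (\<integral>\<^sup>+z. f z \<partial>lborel) = (\<integral>\<^sup>+\<theta>\<in>{0..2 * pi}. (\<integral>\<^sup>+z. f z \<partial>lborel) \<partial>lborel)"
    by (simp add: nn_integral_cmult mult.commute)
  also have "\<dots> = (\<integral>\<^sup>+\<theta>. (\<integral>\<^sup>+z. f (cis \<theta> * z) * indicator {0..2 * pi} \<theta> \<partial>lborel) \<partial>lborel)"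
    by (simp add: nn_integral_multc nn_integral_cis_mult)
  also have "\<dots> = (\<integral>\<^sup>+z. F (cmod z) \<partial>lborel)"
    by (subst lborel_pair.Fubini') (simp_all add: F_cmod)
  also have "\<dots> = (\<integral>\<^sup>+r. F r \<partial>distr lborel borel cmod)"
    by (subst nn_integral_distr) auto
  also have "\<dots> = (\<integral>\<^sup>+r. ennreal (2 * pi) * (ennreal r * F r * indicator {0..} r) \<partial>lborel)"
    unfolding distr_lborel_cmod
    by (subst nn_integral_density)
       (auto simp: ennreal_mult' mult_ac intro!: nn_integral_cong split: split_indicator)
  also have "\<dots> = ennreal (2 * pi) * (\<integral>\<^sup>+r\<in>{0..}. ennreal r * F r \<partial>lborel)"
    by (rule nn_integral_cmult) auto
  finally show ?thesis
    by (simp add: ennreal_mult_cancel_left F_def)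
qed

text \<open>\<open>Arg2pi\<close> jumps across the positive real axis, but to its smaller value
  there, so its sublevel sets are still closed.\<close>

lemma measurable_Arg2pi [measurable (raw)]:
  assumes "f \<in> borel_measurable M"
  shows "(\<lambda>x. Arg2pi (f x)) \<in> borel_measurable M"
proof -
  have "Arg2pi \<in> borel_measurable borel"
    by (rule borel_measurableI_le) (use closed_Arg2pi2pi_le in auto)
  then show ?thesis
    using assms by simp
qed

text \<open>On the polar parametrisation \<open>Arg2pi\<close> returns the angle except at
  \<open>2 * pi\<close>, a null set, and at radius \<open>0\<close>, where the Jacobian factor
  vanishes.\<close>

lemma nn_integral_Arg2pi_cmod:
  assumes [measurable]: "(\<lambda>(\<theta>, r). g \<theta> r) \<in> borel_measurable (borel \<Otimes>\<^sub>M borel)"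
  shows "(\<integral>\<^sup>+z. g (Arg2pi z) (cmod z) \<partial>lborel) =
    (\<integral>\<^sup>+r\<in>{0..}. ennreal r * (\<integral>\<^sup>+\<theta>\<in>{0..2 * pi}. g \<theta> r \<partial>lborel) \<partial>lborel)"
proof -
  have [measurable]: "(\<lambda>z. g (Arg2pi z) (cmod z)) \<in> borel_measurable borel"
    by measurable
  have "(\<integral>\<^sup>+\<theta>\<in>{0..2 * pi}. g (Arg2pi (complex_of_real r * cis \<theta>)) (cmod (complex_of_real r * cis \<theta>)) \<partial>lborel)
      = (\<integral>\<^sup>+\<theta>\<in>{0..2 * pi}. g \<theta> r \<partial>lborel)" if "r > 0" for r
  proof (rule nn_integral_cong_AE)
    have "AE \<theta> in lborel. \<theta> \<noteq> 2 * pi"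
      by (rule AE_lborel_singleton)
    then show "AE \<theta> in lborel. g (Arg2pi (complex_of_real r * cis \<theta>)) (cmod (complex_of_real r * cis \<theta>)) *
        indicator {0..2 * pi} \<theta> = g \<theta> r * indicator {0..2 * pi} \<theta>"
    proof eventually_elim
      case (elim \<theta>)
      then show ?case
        using that Arg2pi_unique[of r \<theta> "complex_of_real r * cis \<theta>"]
        by (auto simp: norm_mult cis_conv_exp split: split_indicator)
    qed
  qed
  then have "ennreal r * (\<integral>\<^sup>+\<theta>\<in>{0..2 * pi}. g (Arg2pi (complex_of_real r * cis \<theta>)) (cmod (complex_of_real r * cis \<theta>)) \<partial>lborel)
        * indicator {0..} r = ennreal r * (\<integral>\<^sup>+\<theta>\<in>{0..2 * pi}. g \<theta> r \<partial>lborel) * indicator {0..} r" for r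
    by (cases "r > 0") (auto split: split_indicator simp: not_less ennreal_neg)
  then show ?thesis
    by (simp add: nn_integral_polar)
qed

lemma prob_space_uniform_circle: "prob_space (uniform_measure lborel {0..2 * pi})"
  by (rule prob_space_uniform_measure) auto

section \<open>Integrals of the rotation invariant weight\<close>

definition radial_measure :: "(real \<Rightarrow> real) \<Rightarrow> nat \<Rightarrow> real measure" where
  "radial_measure \<phi> k = density lborel (\<lambda>r. ennreal (radial_density \<phi> k r))"

text \<open>Preimages of measurable rectangles under argument and modulus; knowing the law of the
  first coordinate on them is enough to identify a product measure.\<close>

definition polar_rect :: "real set \<Rightarrow> real set \<Rightarrow> complex set" where
  "polar_rect A B = {z. Arg2pi z \<in> A \<and> cmod z \<in> B}"

lemma polar_rect_UNIV [simp]: "polar_rect UNIV UNIV = UNIV"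
  by (simp add: polar_rect_def)

lemma polar_rect_sets [measurable]:
  assumes [measurable]: "A \<in> sets borel" "B \<in> sets borel"
  shows "polar_rect A B \<in> sets borel"
  unfolding polar_rect_def by measurable

lemma sets_radial_measure [simp, measurable_cong]: "sets (radial_measure \<phi> k) = sets borel"
  by (simp add: radial_measure_def)

lemma space_radial_measure [simp]: "space (radial_measure \<phi> k) = UNIV"
  by (simp add: radial_measure_def)

context
  fixes \<phi> :: "real \<Rightarrow> real"
  assumes \<phi> [measurable]: "\<phi> \<in> borel_measurable borel" and \<phi>_nonneg: "\<And>r. 0 \<le> \<phi> r"
begin

section \<open>Radial densities, moments and one-variable integrals\<close>

lemma measurable_radial_density [measurable]: "radial_density \<phi> k \<in> borel_measurable borel"
  unfolding radial_density_def by measurable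

lemma radial_density_nonneg: "0 \<le> radial_density \<phi> k r"
  by (auto simp: radial_density_def \<phi>_nonneg split: split_indicator)

text \<open>Undoes the normalisation in \<open>radial_density\<close>. Positivity and finiteness
  keep \<open>enn2real\<close> of the moment away from its value \<open>0\<close> at both zero and
  infinity.\<close>

lemma nn_integral_radial_moment:
  assumes "0 < radial_moment \<phi> k" "radial_moment \<phi> k < \<infinity>" and [measurable]: "B \<in> sets borel"
  shows "(\<integral>\<^sup>+r\<in>{0..}. ennreal (r ^ (2 * k - 1) * \<phi> r) * indicator B r \<partial>lborel) =
    radial_moment \<phi> k * emeasure (radial_measure \<phi> k) B"
proof -
  define m where "m = enn2real (radial_moment \<phi> k)"
  have m: "radial_moment \<phi> k = ennreal m" "m > 0"
    using assms(1,2) by (auto simp: m_def enn2real_positive_iff)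
  have "radial_moment \<phi> k * emeasure (radial_measure \<phi> k) B =
      (\<integral>\<^sup>+r. ennreal m * (ennreal (radial_density \<phi> k r) * indicator B r) \<partial>lborel)"
    by (simp add: m radial_measure_def emeasure_density nn_integral_cmult)
  also have "\<dots> = (\<integral>\<^sup>+r\<in>{0..}. ennreal (r ^ (2 * k - 1) * \<phi> r) * indicator B r \<partial>lborel)"
    using m(2) by (intro nn_integral_cong)
      (auto simp: radial_density_def m(1) simp flip: ennreal_mult' split: split_indicator)
  finally show ?thesis ..
qed

lemma prob_space_radial_measure:
  assumes "0 < radial_moment \<phi> k" "radial_moment \<phi> k < \<infinity>"
  shows "prob_space (radial_measure \<phi> k)"
proof
  have "radial_moment \<phi> k * emeasure (radial_measure \<phi> k) UNIV = radial_moment \<phi> k * 1"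
    using nn_integral_radial_moment[OF assms, of UNIV] by (simp add: radial_moment_def)
  then show "emeasure (radial_measure \<phi> k) (space (radial_measure \<phi> k)) = 1"
    using assms by (auto simp: ennreal_mult_cancel_left simp del: mult_1_right)
qed

text \<open>The weight depends on the modulus alone, so in polar coordinates the angular condition
  contributes only a constant. The index \<open>Suc k\<close> arises because the Jacobian raises the
  exponent \<open>2 * k\<close> by one.\<close>

lemma nn_integral_polar_rect:
  assumes [measurable]: "A \<in> sets borel" "B \<in> sets borel"
    and "0 < radial_moment \<phi> (Suc k)" "radial_moment \<phi> (Suc k) < \<infinity>"
  shows "(\<integral>\<^sup>+z. ennreal (cmod z ^ (2 * k) * \<phi> (cmod z) * indicator (polar_rect A B) z) \<partial>lborel) =
    2 * pi * radial_moment \<phi> (Suc k) * emeasure (uniform_measure lborel {0..2 * pi}) A *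
      emeasure (radial_measure \<phi> (Suc k)) B"
proof -
  have "(\<integral>\<^sup>+z. ennreal (cmod z ^ (2 * k) * \<phi> (cmod z) * indicator (polar_rect A B) z) \<partial>lborel) =
      (\<integral>\<^sup>+z. ennreal (cmod z ^ (2 * k) * \<phi> (cmod z)) * indicator B (cmod z) * indicator A (Arg2pi z) \<partial>lborel)"
    by (intro nn_integral_cong) (auto simp: polar_rect_def split: split_indicator)
  also have "\<dots> = (\<integral>\<^sup>+r\<in>{0..}. ennreal r * (\<integral>\<^sup>+\<theta>\<in>{0..2 * pi}.
      ennreal (r ^ (2 * k) * \<phi> r) * indicator B r * indicator A \<theta> \<partial>lborel) \<partial>lborel)"
    by (rule nn_integral_Arg2pi_cmod[where
        g = "\<lambda>\<theta> r. ennreal (r ^ (2 * k) * \<phi> r) * indicator B r * indicator A \<theta>"]) measurable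
  also have "\<dots> = (\<integral>\<^sup>+r. emeasure lborel ({0..2 * pi} \<inter> A) *
      (ennreal (r ^ (2 * Suc k - 1) * \<phi> r) * indicator B r * indicator {0..} r) \<partial>lborel)"
  proof (intro nn_integral_cong)
    fix r :: real
    have "(\<integral>\<^sup>+\<theta>\<in>{0..2 * pi}. ennreal (r ^ (2 * k) * \<phi> r) * indicator B r * indicator A \<theta> \<partial>lborel) =
        (\<integral>\<^sup>+\<theta>. (ennreal (r ^ (2 * k) * \<phi> r) * indicator B r) * indicator ({0..2 * pi} \<inter> A) \<theta> \<partial>lborel)"
      by (intro nn_integral_cong) (auto split: split_indicator)
    also have "\<dots> = ennreal (r ^ (2 * k) * \<phi> r) * indicator B r * emeasure lborel ({0..2 * pi} \<inter> A)"
      by (subst nn_integral_cmult) auto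
    finally show "ennreal r * (\<integral>\<^sup>+\<theta>\<in>{0..2 * pi}. ennreal (r ^ (2 * k) * \<phi> r) * indicator B r * indicator A \<theta> \<partial>lborel) * indicator {0..} r =
        emeasure lborel ({0..2 * pi} \<inter> A) * (ennreal (r ^ (2 * Suc k - 1) * \<phi> r) * indicator B r * indicator {0..} r)"
      by (auto simp: ennreal_mult' \<phi>_nonneg mult_ac split: split_indicator)
  qed
  also have "\<dots> = emeasure lborel ({0..2 * pi} \<inter> A) *
      (radial_moment \<phi> (Suc k) * emeasure (radial_measure \<phi> (Suc k)) B)"
    unfolding nn_integral_radial_moment[OF assms(3,4,2), symmetric] by (rule nn_integral_cmult) measurable
  also have "emeasure lborel ({0..2 * pi} \<inter> A) = ennreal (2 * pi) * emeasure (uniform_measure lborel {0..2 * pi}) A"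
    by (simp add: ennreal_times_divide mult.commute[of "ennreal _"]) 
       (simp add: ennreal_mult_divide_eq)
  finally show ?thesis
    by (simp add: mult_ac)
qed

text \<open>The indicator belongs to the factor so that an event about one coordinate still leaves a
  product of one-variable functions.\<close>

definition monomial_weight :: "nat \<Rightarrow> nat \<Rightarrow> complex set \<Rightarrow> complex \<Rightarrow> complex" where
  "monomial_weight a b S z = z ^ a * cnj z ^ b * of_real (\<phi> (cmod z)) * indicator S z"

lemma measurable_monomial_weight [measurable]:
  assumes [measurable]: "S \<in> sets borel"
  shows "monomial_weight a b S \<in> borel_measurable borel"
proof -
  have [measurable]: "cnj \<in> borel_measurable borel" "(of_real :: real \<Rightarrow> complex) \<in> borel_measurable borel"
    by (auto intro!: borel_measurable_continuous_onI continuous_intros)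
  show ?thesis
    unfolding monomial_weight_def by measurable
qed

text \<open>With x = |z|^a and y = |z|^b, the inequality 2xy \<le> x^2 + y^2 bounds the mixed term
  by two diagonal ones, whose integrals are finite multiples of the moments.\<close>

lemma integrable_monomial_weight:
  assumes [measurable]: "S \<in> sets borel"
    and "0 < radial_moment \<phi> (Suc a)" "radial_moment \<phi> (Suc a) < \<infinity>"
    and "0 < radial_moment \<phi> (Suc b)" "radial_moment \<phi> (Suc b) < \<infinity>"
  shows "integrable lborel (monomial_weight a b S)"
proof (rule Bochner_Integration.integrable_bound)
  have "integrable lborel (\<lambda>z. cmod z ^ (2 * k) * \<phi> (cmod z))"
    if "0 < radial_moment \<phi> (Suc k)" "radial_moment \<phi> (Suc k) < \<infinity>" for k
  proof (rule integrableI_bounded)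
    have "(\<integral>\<^sup>+z. ennreal (norm (cmod z ^ (2 * k) * \<phi> (cmod z))) \<partial>lborel) =
        (\<integral>\<^sup>+z. ennreal (cmod z ^ (2 * k) * \<phi> (cmod z) * indicator (polar_rect UNIV UNIV) z) \<partial>lborel)"
      by (simp add: \<phi>_nonneg)
    also have "\<dots> < \<infinity>"
      using that prob_space.emeasure_space_1[OF prob_space_radial_measure[OF that]]
        prob_space.emeasure_space_1[OF prob_space_uniform_circle]
      by (subst nn_integral_polar_rect) (auto simp: ennreal_mult_less_top)
    finally show "(\<integral>\<^sup>+z. ennreal (norm (cmod z ^ (2 * k) * \<phi> (cmod z))) \<partial>lborel) < \<infinity>" .
  qed measurable
  then show "integrable lborel (\<lambda>z. cmod z ^ (2 * a) * \<phi> (cmod z) + cmod z ^ (2 * b) * \<phi> (cmod z))"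
    using assms by (intro Bochner_Integration.integrable_add) auto
  have "norm (monomial_weight a b S z) \<le> norm (cmod z ^ (2 * a) * \<phi> (cmod z) + cmod z ^ (2 * b) * \<phi> (cmod z))" for z
  proof -
    have "2 * (cmod z ^ a * cmod z ^ b) \<le> cmod z ^ (2 * a) + cmod z ^ (2 * b)"
      using sum_squares_bound[of "cmod z ^ a" "cmod z ^ b"] by (simp add: power_mult mult.commute[of 2] mult.assoc)
    then have "cmod z ^ a * cmod z ^ b \<le> cmod z ^ (2 * a) + cmod z ^ (2 * b)"
      by (smt (verit) mult_nonneg_nonneg norm_ge_zero zero_le_power)
    then have "cmod z ^ a * cmod z ^ b * \<phi> (cmod z) \<le> (cmod z ^ (2 * a) + cmod z ^ (2 * b)) * \<phi> (cmod z)"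
      by (intro mult_right_mono \<phi>_nonneg)
    then show ?thesis
      by (auto simp: monomial_weight_def norm_mult norm_power \<phi>_nonneg distrib_right split: split_indicator)
  qed
  then show "AE z in lborel. norm (monomial_weight a b S z) \<le> norm (cmod z ^ (2 * a) * \<phi> (cmod z) + cmod z ^ (2 * b) * \<phi> (cmod z))"
    by simp
qed measurable

lemma integral_monomial_weight_diagonal:
  assumes [measurable]: "A \<in> sets borel" "B \<in> sets borel"
    and k: "0 < radial_moment \<phi> (Suc k)" "radial_moment \<phi> (Suc k) < \<infinity>"
  shows "integral\<^sup>L lborel (monomial_weight k k (polar_rect A B)) =
    of_real (2 * pi * enn2real (radial_moment \<phi> (Suc k)) * measure (uniform_measure lborel {0..2 * pi}) A *
      measure (radial_measure \<phi> (Suc k)) B)"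
proof -
  have "z ^ k * cnj z ^ k = of_real (cmod z ^ (2 * k))" for z
    by (simp only: power_mult of_real_power[of "(cmod z)\<^sup>2"] complex_norm_square power_mult_distrib)
  then have "monomial_weight k k (polar_rect A B) =
      (\<lambda>z. of_real (cmod z ^ (2 * k) * \<phi> (cmod z) * indicator (polar_rect A B) z))"
    by (auto simp: monomial_weight_def fun_eq_iff split: split_indicator)
  then have "integral\<^sup>L lborel (monomial_weight k k (polar_rect A B)) =
      of_real (\<integral>z. cmod z ^ (2 * k) * \<phi> (cmod z) * indicator (polar_rect A B) z \<partial>lborel)"
    by (simp only: integral_complex_of_real)
  also have "(\<integral>z. cmod z ^ (2 * k) * \<phi> (cmod z) * indicator (polar_rect A B) z \<partial>lborel) =
      enn2real (\<integral>\<^sup>+z. ennreal (cmod z ^ (2 * k) * \<phi> (cmod z) * indicator (polar_rect A B) z) \<partial>lborel)"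
    by (rule integral_eq_nn_integral) (auto simp: \<phi>_nonneg)
  also have "\<dots> = 2 * pi * enn2real (radial_moment \<phi> (Suc k)) * measure (uniform_measure lborel {0..2 * pi}) A *
      measure (radial_measure \<phi> (Suc k)) B"
    using k by (subst nn_integral_polar_rect) (auto simp: enn2real_mult measure_def)
  finally show ?thesis .
qed

text \<open>Rotating by \<open>\<alpha>\<close> multiplies the integrand by e^(i (a - b) \<alpha>).
  Choosing this angle to be \<open>pi\<close> gives the factor \<open>-1\<close>, so the integral
  equals its own negative.\<close>

lemma integral_monomial_weight_off_diagonal:
  assumes "a \<noteq> b"
  shows "integral\<^sup>L lborel (monomial_weight a b UNIV) = 0"
proof -
  define \<alpha> where "\<alpha> = pi / (real a - real b)"
  have "cis \<alpha> ^ a * cnj (cis \<alpha>) ^ b = cis (real a * \<alpha> + real b * - \<alpha>)"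
    by (simp only: cis_cnj Complex.DeMoivre cis_mult)
  also have "real a * \<alpha> + real b * - \<alpha> = \<alpha> * (real a - real b)"
    by (simp add: algebra_simps)
  also have "cis (\<alpha> * (real a - real b)) = -1"
    using assms by (simp add: \<alpha>_def)
  finally have cis: "cis \<alpha> ^ a * cnj (cis \<alpha>) ^ b = -1" .
  have "monomial_weight a b UNIV (cis \<alpha> * z) = cis \<alpha> ^ a * cnj (cis \<alpha>) ^ b * monomial_weight a b UNIV z" for z
    by (simp add: monomial_weight_def power_mult_distrib norm_mult mult_ac)
  then have "monomial_weight a b UNIV (cis \<alpha> * z) = - monomial_weight a b UNIV z" for z
    unfolding cis by simp
  then have "(\<integral>z. monomial_weight a b UNIV z \<partial>lborel) = (\<integral>z. - monomial_weight a b UNIV z \<partial>lborel)"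
    by (subst integral_cis_mult[of _ \<alpha>, symmetric]) simp_all
  then show ?thesis
    by simp
qed

text \<open>Coordinates are numbered from 1 and exponents from 0, whence \<open>j - 1\<close>. The
  second permutation comes from the conjugate factor in \<open>V * cnj V\<close>.\<close>

lemma rot_inv_weight_eq_sum:
  "of_real (rot_inv_weight n \<phi> z) =
    (\<Sum>p | p permutes {0..<n}. \<Sum>q | q permutes {0..<n}. of_int (sign p * sign q) *
      (\<Prod>j=1..n. monomial_weight (p (j - 1)) (q (j - 1)) UNIV (z j)))"
proof -
  define V where "V = (\<Prod>k<n. \<Prod>j<k. z (Suc k) - z (Suc j))"
  have reindex: "(\<Prod>i<n. g i) = (\<Prod>j=1..n. g (j - 1))" for g :: "nat \<Rightarrow> complex"
    by (rule prod.reindex_bij_witness[where i = "\<lambda>j. j - 1" and j = Suc]) auto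
  have V_sum: "V = (\<Sum>p | p permutes {0..<n}. of_int (sign p) * (\<Prod>j=1..n. z j ^ p (j - 1)))"
    unfolding V_def prod_diff_eq_sum_permutations[of "\<lambda>i. z (Suc i)"] reindex
    by (auto intro!: sum.cong prod.cong)
  \<comment> \<open>The index pairs are swapped and shifted to match the orientation of the
    Vandermonde product; the modulus hides the resulting sign of each difference.\<close>
  have "(\<Prod>(j, k)\<in>{(j, k). 1 \<le> j \<and> j < k \<and> k \<le> n}. (cmod (z j - z k))\<^sup>2) =
      (\<Prod>(k, j)\<in>Sigma {..<n} (\<lambda>k. {..<k}). (cmod (z (Suc k) - z (Suc j)))\<^sup>2)"
    by (rule prod.reindex_bij_witness[where i = "\<lambda>(k, j). (Suc j, Suc k)" and j = "\<lambda>(j, k). (k - 1, j - 1)"])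
       (auto simp: norm_minus_commute)
  also have "\<dots> = (cmod V)\<^sup>2"
    by (subst prod.Sigma[symmetric]) (simp_all add: V_def prod_norm flip: prod_power_distrib)
  finally have "of_real (rot_inv_weight n \<phi> z) = V * cnj V * (\<Prod>j=1..n. of_real (\<phi> (cmod (z j))))"
    by (simp add: rot_inv_weight_def complex_norm_square flip: of_real_power)
  also have "V * cnj V = (\<Sum>p | p permutes {0..<n}. \<Sum>q | q permutes {0..<n}.
      of_int (sign p) * (\<Prod>j=1..n. z j ^ p (j - 1)) * (of_int (sign q) * (\<Prod>j=1..n. cnj (z j) ^ q (j - 1))))"
    unfolding V_sum cnj_sum sum_product by simp
  finally show ?thesis
    by (simp add: sum_distrib_left sum_distrib_right monomial_weight_def prod.distrib mult_ac)
qed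

section \<open>Integration of the full weight over all coordinates\<close>

lemma measurable_rot_inv_weight [measurable]:
  "rot_inv_weight n \<phi> \<in> borel_measurable (\<Pi>\<^sub>M j\<in>{1..n}. (lborel :: complex measure))"
proof -
  have comp: "(\<lambda>z. z j) \<in> borel_measurable (\<Pi>\<^sub>M j\<in>{1..n}. (lborel :: complex measure))" if "1 \<le> j" "j \<le> n" for j
    using that measurable_component_singleton[of j "{1..n}" "\<lambda>_. lborel :: complex measure"] by simp
  show ?thesis
    unfolding rot_inv_weight_def[abs_def] split_beta
    by (intro borel_measurable_times borel_measurable_prod borel_measurable_power borel_measurable_norm
        borel_measurable_diff comp measurable_compose[OF _ \<phi>]) auto
qed

lemma rot_inv_weight_nonneg: "0 \<le> rot_inv_weight n \<phi> z"
  unfolding rot_inv_weight_def by (intro mult_nonneg_nonneg prod_nonneg) (auto simp: \<phi>_nonneg)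

lemma integrable_prod_monomial_weight:
  assumes "\<And>k. k < n \<Longrightarrow> 0 < radial_moment \<phi> (Suc k) \<and> radial_moment \<phi> (Suc k) < \<infinity>"
    and "p permutes {0..<n}" "q permutes {0..<n}" "\<And>j. S j \<in> sets borel"
  shows "integrable (\<Pi>\<^sub>M j\<in>{1..n}. lborel) (\<lambda>z. \<Prod>j=1..n. monomial_weight (p (j - 1)) (q (j - 1)) (S j) (z j))"
    and "(\<integral>z. (\<Prod>j=1..n. monomial_weight (p (j - 1)) (q (j - 1)) (S j) (z j)) \<partial>(\<Pi>\<^sub>M j\<in>{1..n}. lborel)) =
      (\<Prod>j=1..n. integral\<^sup>L lborel (monomial_weight (p (j - 1)) (q (j - 1)) (S j)))"
proof -
  interpret product_sigma_finite "\<lambda>_ :: nat. lborel :: complex measure"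
    by standard
  have int: "integrable lborel (monomial_weight (p (j - 1)) (q (j - 1)) (S j))" if "j \<in> {1..n}" for j
  proof -
    have "p (j - 1) < n" "q (j - 1) < n"
      using that permutes_in_image[OF assms(2), of "j - 1"] permutes_in_image[OF assms(3), of "j - 1"] by auto
    then show ?thesis
      using assms(1,4) by (intro integrable_monomial_weight) auto
  qed
  show "integrable (\<Pi>\<^sub>M j\<in>{1..n}. lborel) (\<lambda>z. \<Prod>j=1..n. monomial_weight (p (j - 1)) (q (j - 1)) (S j) (z j))"
    by (rule product_integrable_prod) (use int in auto)
  show "(\<integral>z. (\<Prod>j=1..n. monomial_weight (p (j - 1)) (q (j - 1)) (S j) (z j)) \<partial>(\<Pi>\<^sub>M j\<in>{1..n}. lborel)) =
      (\<Prod>j=1..n. integral\<^sup>L lborel (monomial_weight (p (j - 1)) (q (j - 1)) (S j)))"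
    by (rule product_integral_prod) (use int in auto)
qed

text \<open>By Fubini the integral is a product of one-variable integrals. Equal permutations give
  one moment factor per coordinate, and only the first coordinate sees \<open>A\<close> and
  \<open>B\<close>, through the exponent \<open>p 0\<close>.\<close>

lemma integral_prod_monomial_weight:
  assumes mom: "\<And>k. k < n \<Longrightarrow> 0 < radial_moment \<phi> (Suc k) \<and> radial_moment \<phi> (Suc k) < \<infinity>"
    and "n \<ge> 1" and p: "p permutes {0..<n}" and q: "q permutes {0..<n}"
    and AB [measurable]: "A \<in> sets borel" "B \<in> sets borel"
  defines "S \<equiv> \<lambda>j. if j = 1 then polar_rect A B else UNIV"
  shows "(\<integral>z. (\<Prod>j=1..n. monomial_weight (p (j - 1)) (q (j - 1)) (S j) (z j)) \<partial>(\<Pi>\<^sub>M j\<in>{1..n}. lborel)) =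
    (if q = p then of_real ((\<Prod>k<n. 2 * pi * enn2real (radial_moment \<phi> (Suc k))) *
        measure (uniform_measure lborel {0..2 * pi}) A * measure (radial_measure \<phi> (Suc (p 0))) B) else 0)"
proof -
  have S: "S j \<in> sets borel" for j
    by (simp add: S_def)
  have eq: "(\<integral>z. (\<Prod>j=1..n. monomial_weight (p (j - 1)) (q (j - 1)) (S j) (z j)) \<partial>(\<Pi>\<^sub>M j\<in>{1..n}. lborel)) =
      (\<Prod>j=1..n. integral\<^sup>L lborel (monomial_weight (p (j - 1)) (q (j - 1)) (S j)))"
    by (rule integrable_prod_monomial_weight(2)) (use mom p q S in auto)
  show ?thesis
  proof (cases "q = p")
    case False
    \<comment> \<open>Differing permutations must differ away from \<open>0\<close>, hence at a
      coordinate where \<open>S\<close> is \<open>UNIV\<close> and orthogonality applies.\<close>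
    then obtain i where i: "i \<in> {0..<n} - {0}" "p i \<noteq> q i"
      using permutes_eq_if_eq_except_one[OF p q, of 0] by auto
    then have "integral\<^sup>L lborel (monomial_weight (p (Suc i - 1)) (q (Suc i - 1)) (S (Suc i))) = 0"
      by (simp add: S_def integral_monomial_weight_off_diagonal)
    then have "(\<Prod>j=1..n. integral\<^sup>L lborel (monomial_weight (p (j - 1)) (q (j - 1)) (S j))) = 0"
      using i by (intro prod_zero bexI[of _ "Suc i"]) auto
    then show ?thesis
      using False eq by simp
  next
    case True
    define m where "m = (\<lambda>k. 2 * pi * enn2real (radial_moment \<phi> (Suc k)))"
    define c where "c = measure (uniform_measure lborel {0..2 * pi}) A * measure (radial_measure \<phi> (Suc (p 0))) B"
    have p_less: "p (j - 1) < n" if "j \<in> {1..n}" for j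
      using that permutes_in_image[OF p, of "j - 1"] by auto
    have "integral\<^sup>L lborel (monomial_weight (p (j - 1)) (p (j - 1)) (S j)) =
        of_real (m (p (j - 1)) * (if j = 1 then c else 1))" if "j \<in> {1..n}" for j
    proof -
      have k: "0 < radial_moment \<phi> (Suc (p (j - 1)))" "radial_moment \<phi> (Suc (p (j - 1))) < \<infinity>"
        using mom p_less[OF that] by auto
      show ?thesis
        using integral_monomial_weight_diagonal[OF AB k] integral_monomial_weight_diagonal[OF _ _ k, of UNIV UNIV]
          prob_space.prob_space[OF prob_space_radial_measure[OF k]] prob_space.prob_space[OF prob_space_uniform_circle]
        by (auto simp: S_def m_def c_def)
    qed
    then have "(\<Prod>j=1..n. integral\<^sup>L lborel (monomial_weight (p (j - 1)) (q (j - 1)) (S j))) =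
        (\<Prod>j=1..n. of_real (m (p (j - 1)) * (if j = 1 then c else 1)))"
      unfolding True by (intro prod.cong refl)
    also have "\<dots> = of_real ((\<Prod>j=1..n. m (p (j - 1))) * (\<Prod>j=1..n. if j = 1 then c else 1))"
      by (simp only: of_real_prod of_real_mult prod.distrib)
    also have "(\<Prod>j=1..n. m (p (j - 1))) = (\<Prod>i\<in>{0..<n}. m (p i))"
      by (rule prod.reindex_bij_witness[where j = "\<lambda>j. j - 1" and i = Suc]) auto
    \<comment> \<open>Each exponent occurs exactly once, so the product of the moments does not
      depend on \<open>p\<close>.\<close>
    also have "\<dots> = (\<Prod>k<n. m k)"
      using prod.permute[OF p, of m] by (simp add: lessThan_atLeast0 o_def)
    also have "(\<Prod>j=1..n. if j = 1 then c else 1) = c"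
      using \<open>n \<ge> 1\<close> by (simp add: prod.delta)
    finally show ?thesis
      unfolding eq if_P[OF True] by (simp only: m_def c_def mult.assoc)
  qed
qed

text \<open>The diagonal terms differ only in the value \<open>p 0\<close>, and every value in the
  range is taken by the same number of permutations; this turns the sum over permutations into an
  unweighted sum of the radial measures.\<close>

lemma integral_rot_inv_weight_polar_rect:
  assumes mom: "\<And>k. k < n \<Longrightarrow> 0 < radial_moment \<phi> (Suc k) \<and> radial_moment \<phi> (Suc k) < \<infinity>"
    and n: "n \<ge> 1" and AB [measurable]: "A \<in> sets borel" "B \<in> sets borel"
  shows "integrable (\<Pi>\<^sub>M j\<in>{1..n}. lborel) (\<lambda>z. rot_inv_weight n \<phi> z * indicator (polar_rect A B) (z 1))" (is ?int)
    and "(\<integral>z. rot_inv_weight n \<phi> z * indicator (polar_rect A B) (z 1) \<partial>(\<Pi>\<^sub>M j\<in>{1..n}. lborel)) =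
      (\<Prod>k<n. 2 * pi * enn2real (radial_moment \<phi> (Suc k))) * real (card {p. p permutes {0..<n} \<and> p 0 = 0}) *
      measure (uniform_measure lborel {0..2 * pi}) A * (\<Sum>k<n. measure (radial_measure \<phi> (Suc k)) B)"
      (is "?lhs = ?rhs")
proof -
  define S where "S = (\<lambda>j :: nat. if j = 1 then polar_rect A B else UNIV)"
  define C where "C = (\<Prod>k<n. 2 * pi * enn2real (radial_moment \<phi> (Suc k))) * measure (uniform_measure lborel {0..2 * pi}) A"
  define g where "g = (\<lambda>p q z. \<Prod>j=1..n. monomial_weight (p (j - 1)) (q (j - 1)) (S j) (z j))"
  let ?P = "{p. p permutes {0..<n}}"
  have fin: "finite ?P"
    by (simp add: finite_permutations)
  have S: "S j \<in> sets borel" for j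
    by (simp add: S_def)
  \<comment> \<open>The indicator of the event is absorbed into the factor at coordinate 1, the
    other indicators being identically one.\<close>
  have g_eq: "(\<Prod>j=1..n. monomial_weight (p (j - 1)) (q (j - 1)) UNIV (z j)) * indicator (polar_rect A B) (z 1) = g p q z" for p q z
  proof -
    have "(\<Prod>j=1..n. indicator (S j) (z j)) = (\<Prod>j=1..n. if j = 1 then indicator (polar_rect A B) (z 1) else 1 :: complex)"
      by (intro prod.cong) (auto simp: S_def)
    also have "\<dots> = indicator (polar_rect A B) (z 1)"
      using n by (simp add: prod.delta)
    finally show ?thesis
      by (simp add: g_def monomial_weight_def prod.distrib)
  qed
  have weight: "of_real (rot_inv_weight n \<phi> z * indicator (polar_rect A B) (z 1)) =
      (\<Sum>p\<in>?P. \<Sum>q\<in>?P. of_int (sign p * sign q) * g p q z)" for z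
    unfolding of_real_mult rot_inv_weight_eq_sum of_real_indicator sum_distrib_right mult.assoc g_eq ..
  have int: "integrable (\<Pi>\<^sub>M j\<in>{1..n}. lborel) (g p q)" if "p \<in> ?P" "q \<in> ?P" for p q
    unfolding g_def using that mom S by (intro integrable_prod_monomial_weight(1)) auto
  then have "integrable (\<Pi>\<^sub>M j\<in>{1..n}. lborel)
      (\<lambda>z. complex_of_real (rot_inv_weight n \<phi> z * indicator (polar_rect A B) (z 1)))"
    unfolding weight by (intro Bochner_Integration.integrable_sum integrable_mult_right) auto
  then show ?int
    by (simp only: complex_of_real_integrable_eq)
  have "complex_of_real ?lhs = (\<integral>z. (\<Sum>p\<in>?P. \<Sum>q\<in>?P. of_int (sign p * sign q) * g p q z) \<partial>(\<Pi>\<^sub>M j\<in>{1..n}. lborel))"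
    by (simp only: weight flip: integral_complex_of_real)
  also have "\<dots> = (\<Sum>p\<in>?P. \<Sum>q\<in>?P. of_int (sign p * sign q) * (\<integral>z. g p q z \<partial>(\<Pi>\<^sub>M j\<in>{1..n}. lborel)))"
  proof -
    have int': "integrable (\<Pi>\<^sub>M j\<in>{1..n}. lborel) (\<lambda>z. of_int (sign p * sign q) * g p q z)"
      if "p \<in> ?P" "q \<in> ?P" for p q
      using int[OF that] by (rule integrable_mult_right)
    have "(\<integral>z. (\<Sum>p\<in>?P. \<Sum>q\<in>?P. of_int (sign p * sign q) * g p q z) \<partial>(\<Pi>\<^sub>M j\<in>{1..n}. lborel)) =
        (\<Sum>p\<in>?P. \<integral>z. (\<Sum>q\<in>?P. of_int (sign p * sign q) * g p q z) \<partial>(\<Pi>\<^sub>M j\<in>{1..n}. lborel))"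
      by (rule Bochner_Integration.integral_sum) (rule Bochner_Integration.integrable_sum, rule int')
    also have "\<dots> = (\<Sum>p\<in>?P. \<Sum>q\<in>?P. \<integral>z. of_int (sign p * sign q) * g p q z \<partial>(\<Pi>\<^sub>M j\<in>{1..n}. lborel))"
      by (intro sum.cong refl Bochner_Integration.integral_sum) (rule int')
    finally show ?thesis
      by simp
  qed
  \<comment> \<open>On the surviving diagonal \<open>q = p\<close> the two signs multiply to one, so
    no cancellation remains.\<close>
  also have "\<dots> = (\<Sum>p\<in>?P. \<Sum>q\<in>?P. if q = p then of_real (C * measure (radial_measure \<phi> (Suc (p 0))) B) else 0)"
    unfolding g_def S_def C_def
    by (intro sum.cong refl, subst integral_prod_monomial_weight) (use mom n in \<open>auto simp: sign_idempotent simp flip: of_int_mult\<close>)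
  also have "\<dots> = of_real (\<Sum>p\<in>?P. C * measure (radial_measure \<phi> (Suc (p 0))) B)"
    using fin by (simp add: sum.delta)
  also have "(\<Sum>p\<in>?P. C * measure (radial_measure \<phi> (Suc (p 0))) B) =
      C * (\<Sum>p\<in>?P. measure (radial_measure \<phi> (Suc (p 0))) B)"
    by (rule sum_distrib_left[symmetric])
  also have "(\<Sum>p\<in>?P. measure (radial_measure \<phi> (Suc (p 0))) B) =
      real (card {p. p permutes {0..<n} \<and> p 0 = 0}) * (\<Sum>k<n. measure (radial_measure \<phi> (Suc k)) B)"
    unfolding lessThan_atLeast0 using n by (intro sum_permutations_apply) auto
  also have "C * \<dots> = ?rhs"
    by (simp only: C_def mult_ac)
  finally show "?lhs = ?rhs"
    by (simp only: of_real_eq_iff)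
qed

text \<open>All that is known about \<open>c\<close> is that it makes \<open>D\<close> a probability
  measure. It enters only through \<open>C\<close>, together with the moments and the permutation
  count, so one evaluation determines the constant.\<close>

lemma emeasure_density_polar_rect:
  assumes mom: "\<And>k. k < n \<Longrightarrow> 0 < radial_moment \<phi> (Suc k) \<and> radial_moment \<phi> (Suc k) < \<infinity>"
    and n: "n \<ge> 1" and AB [measurable]: "A \<in> sets borel" "B \<in> sets borel" and c: "c > 0"
  defines "D \<equiv> density (\<Pi>\<^sub>M j\<in>{1..n}. (lborel :: complex measure)) (\<lambda>z. ennreal (c * rot_inv_weight n \<phi> z))"
  assumes prob: "prob_space D"
  shows "emeasure D {z \<in> space D. z 1 \<in> polar_rect A B} =
    emeasure (uniform_measure lborel {0..2 * pi}) A *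
    emeasure (density lborel (\<lambda>r. ennreal (mean_radial_density n \<phi> r))) B"
proof -
  define U where "U = uniform_measure lborel {0..2 * pi}"
  interpret U: prob_space U
    unfolding U_def by (rule prob_space_uniform_circle)
  define C where "C = c * (\<Prod>k<n. 2 * pi * enn2real (radial_moment \<phi> (Suc k))) *
    real (card {p. p permutes {0..<n} \<and> p 0 = 0})"
  have comp [measurable]: "(\<lambda>z. z 1) \<in> borel_measurable (\<Pi>\<^sub>M j\<in>{1..n}. (lborel :: complex measure))"
    using n measurable_component_singleton[of 1 "{1..n}" "\<lambda>_. lborel :: complex measure"] by simp
  have radial: "prob_space (radial_measure \<phi> (Suc k))" if "k < n" for k
    using mom[OF that] by (intro prob_space_radial_measure) auto
  have *: "emeasure D {z \<in> space D. z 1 \<in> polar_rect A B} =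
      ennreal (C * measure U A * (\<Sum>k<n. measure (radial_measure \<phi> (Suc k)) B))"
    if [measurable]: "A \<in> sets borel" "B \<in> sets borel" for A B
  proof -
    have meas: "(\<lambda>z. ennreal (c * rot_inv_weight n \<phi> z)) \<in> borel_measurable (\<Pi>\<^sub>M j\<in>{1..n}. lborel)"
      "{z \<in> space (\<Pi>\<^sub>M j\<in>{1..n}. lborel). z 1 \<in> polar_rect A B} \<in> sets (\<Pi>\<^sub>M j\<in>{1..n}. lborel)"
      by measurable
    note integral = integral_rot_inv_weight_polar_rect[OF mom n that]
    have "emeasure D {z \<in> space D. z 1 \<in> polar_rect A B} =
        (\<integral>\<^sup>+z. ennreal (c * (rot_inv_weight n \<phi> z * indicator (polar_rect A B) (z 1))) \<partial>(\<Pi>\<^sub>M j\<in>{1..n}. lborel))"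
      unfolding D_def space_density emeasure_density[OF meas]
      by (intro nn_integral_cong) (auto split: split_indicator)
    also have "\<dots> = ennreal (\<integral>z. c * (rot_inv_weight n \<phi> z * indicator (polar_rect A B) (z 1)) \<partial>(\<Pi>\<^sub>M j\<in>{1..n}. lborel))"
      using c integral(1) by (intro nn_integral_eq_integral) (auto simp: rot_inv_weight_nonneg)
    finally show ?thesis
      using integral(2) by (simp add: C_def U_def mult_ac)
  qed
  \<comment> \<open>On the full rectangle the uniform measure and each of the \<open>n\<close>
    radial measures have mass one, so the total mass is \<open>C * real n\<close>.\<close>
  have "emeasure D {z \<in> space D. z 1 \<in> polar_rect UNIV UNIV} = 1"
    using prob_space.emeasure_space_1[OF prob] by simp
  moreover have "measure U UNIV = 1"
    using U.prob_space by (simp add: U_def)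
  moreover have "measure (radial_measure \<phi> (Suc k)) UNIV = 1" if "k < n" for k
    using prob_space.prob_space[OF radial[OF that]] by simp
  ultimately have "C * real n = 1"
    using *[of UNIV UNIV] by simp
  then have C: "C = 1 / real n"
    using n by (simp add: field_simps)
  have "emeasure (density lborel (\<lambda>r. ennreal (mean_radial_density n \<phi> r))) B =
      (\<integral>\<^sup>+r. (\<Sum>k<n. ennreal (1 / real n) * (ennreal (radial_density \<phi> (Suc k) r) * indicator B r)) \<partial>lborel)"
  proof -
    have "ennreal (mean_radial_density n \<phi> r) = (\<Sum>k<n. ennreal (1 / real n) * ennreal (radial_density \<phi> (Suc k) r))" for r
      using sum.atLeast1_atMost_eq[of "\<lambda>k. radial_density \<phi> k r" n]
      by (simp add: mean_radial_density_def sum_distrib_left radial_density_nonneg flip: ennreal_mult)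
    then show ?thesis
      by (subst emeasure_density)
        (auto simp: mean_radial_density_def[abs_def] sum_distrib_right mult.assoc intro!: nn_integral_cong)
  qed
  also have "\<dots> = (\<Sum>k<n. ennreal (1 / real n) * emeasure (radial_measure \<phi> (Suc k)) B)"
    by (simp add: nn_integral_sum nn_integral_cmult radial_measure_def emeasure_density)
  also have "\<dots> = (\<Sum>k<n. ennreal (1 / real n * measure (radial_measure \<phi> (Suc k)) B))"
    using radial by (intro sum.cong refl)
      (simp add: finite_measure.emeasure_eq_measure prob_space.finite_measure flip: ennreal_mult)
  also have "\<dots> = ennreal (C * (\<Sum>k<n. measure (radial_measure \<phi> (Suc k)) B))"
    by (simp add: C sum_distrib_left)
  finally show ?thesis
    unfolding *[OF AB] U_def[symmetric] U.emeasure_eq_measure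
    by (simp add: C sum_nonneg mult_ac flip: ennreal_mult)
qed

end

section \<open>The joint law of argument and modulus\<close>

text \<open>The event that \<open>Z 1\<close> lies in a polar rectangle has a probability that
  factorises, and two sigma-finite factors determine their product measure from such rectangles.
  Uniformity, the radial density and independence are all contained in this one identity.\<close>

lemma distr_Arg2pi_cmod_eq:
  fixes \<phi> :: "real \<Rightarrow> real" and Z :: "nat \<Rightarrow> 'w \<Rightarrow> complex"
  assumes "\<phi> \<in> borel_measurable borel" "\<And>r. 0 \<le> \<phi> r"
    and mom: "\<And>j. 1 \<le> j \<Longrightarrow> j \<le> n \<Longrightarrow> 0 < radial_moment \<phi> j \<and> radial_moment \<phi> j < \<infinity>"
    and n: "n \<ge> 1" and "prob_space M" and c: "c > 0"
    and Z: "distributed M (\<Pi>\<^sub>M j\<in>{1..n}. (lborel :: complex measure))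
       (\<lambda>\<omega>. \<lambda>j\<in>{1..n}. Z j \<omega>) (\<lambda>z. ennreal (c * rot_inv_weight n \<phi> z))"
  shows "Z 1 \<in> borel_measurable M"
    and "prob_space (density lborel (\<lambda>r. ennreal (mean_radial_density n \<phi> r)))"
    and "distr M (borel \<Otimes>\<^sub>M borel) (\<lambda>\<omega>. (Arg2pi (Z 1 \<omega>), cmod (Z 1 \<omega>))) =
      uniform_measure lborel {0..2 * pi} \<Otimes>\<^sub>M density lborel (\<lambda>r. ennreal (mean_radial_density n \<phi> r))"
proof -
  let ?N = "\<Pi>\<^sub>M j\<in>{1..n}. (lborel :: complex measure)"
  let ?X = "\<lambda>\<omega>. \<lambda>j\<in>{1..n}. Z j \<omega>"
  let ?U = "uniform_measure lborel {0..2 * pi}"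
  let ?R = "density lborel (\<lambda>r. ennreal (mean_radial_density n \<phi> r))"
  interpret prob_space M
    by fact
  note [measurable] = assms(1)
  have X [measurable]: "?X \<in> measurable M ?N"
    using Z by (rule distributed_measurable)
  have comp [measurable]: "(\<lambda>z. z 1) \<in> borel_measurable ?N"
    using n measurable_component_singleton[of 1 "{1..n}" "\<lambda>_. lborel :: complex measure"] by simp
  have "(\<lambda>\<omega>. ?X \<omega> 1) \<in> borel_measurable M"
    by measurable
  then show Z1 [measurable]: "Z 1 \<in> borel_measurable M"
    using n by simp
  define D where "D = density ?N (\<lambda>z. ennreal (c * rot_inv_weight n \<phi> z))"
  have D: "distr M ?N ?X = D"
    using Z by (simp add: distributed_def D_def)
  then have "prob_space D"
    using prob_space_distr[OF X] by simp
  have rect: "emeasure M {\<omega> \<in> space M. Z 1 \<omega> \<in> polar_rect A B} = emeasure ?U A * emeasure ?R B"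
    if [measurable]: "A \<in> sets borel" "B \<in> sets borel" for A B
  proof -
    have meas: "{z \<in> space ?N. z 1 \<in> polar_rect A B} \<in> sets ?N"
      by measurable
    have "emeasure M {\<omega> \<in> space M. Z 1 \<omega> \<in> polar_rect A B} = emeasure D {z \<in> space D. z 1 \<in> polar_rect A B}"
      using n measurable_space[OF X] unfolding D[symmetric] space_distr emeasure_distr[OF X meas]
      by (intro arg_cong[where f = "emeasure M"]) auto
    also have "\<dots> = emeasure ?U A * emeasure ?R B"
      unfolding D_def using \<open>prob_space D\<close> assms(1,2) mom n c
      by (intro emeasure_density_polar_rect) (auto simp: D_def)
    finally show ?thesis .
  qed
  have U: "prob_space ?U"
    by (rule prob_space_uniform_circle)
  \<comment> \<open>The mass of the mean density is read off from the full rectangle, the uniform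
    factor having mass one.\<close>
  have "emeasure ?R UNIV = 1"
    using rect[of UNIV UNIV] prob_space.emeasure_space_1[OF U] emeasure_space_1 by simp
  then show R: "prob_space ?R"
    by (intro prob_spaceI) simp
  show "distr M (borel \<Otimes>\<^sub>M borel) (\<lambda>\<omega>. (Arg2pi (Z 1 \<omega>), cmod (Z 1 \<omega>))) = ?U \<Otimes>\<^sub>M ?R"
  proof (rule pair_measure_eqI[symmetric])
    show "sigma_finite_measure ?U" "sigma_finite_measure ?R"
      using U R by (simp_all add: prob_space_imp_sigma_finite)
    show "sets (?U \<Otimes>\<^sub>M ?R) = sets (distr M (borel \<Otimes>\<^sub>M borel) (\<lambda>\<omega>. (Arg2pi (Z 1 \<omega>), cmod (Z 1 \<omega>))))"
      by (simp cong: sets_pair_measure_cong)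
    fix A B assume "A \<in> sets ?U" "B \<in> sets ?R"
    then have [measurable]: "A \<in> sets borel" "B \<in> sets borel"
      by simp_all
    show "emeasure ?U A * emeasure ?R B =
        emeasure (distr M (borel \<Otimes>\<^sub>M borel) (\<lambda>\<omega>. (Arg2pi (Z 1 \<omega>), cmod (Z 1 \<omega>)))) (A \<times> B)"
      unfolding rect[OF \<open>A \<in> sets borel\<close> \<open>B \<in> sets borel\<close>, symmetric]
      by (subst emeasure_distr, measurable)
        (auto simp: polar_rect_def intro!: arg_cong[where f = "emeasure M"])
  qed
qed

text \<open>A bounded function is integrable for a product of probability measures, so Fubini
  applies with the angle inside. Since \<open>f\<close> vanishes on the negative reals, the outer
  integral may be restricted to \<open>{0..}\<close>.\<close>

lemma integral_uniform_pair:
  fixes g :: "real \<Rightarrow> real \<Rightarrow> complex"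
  assumes [measurable]: "(\<lambda>(\<theta>, r). g \<theta> r) \<in> borel_measurable (borel \<Otimes>\<^sub>M borel)"
    and "bounded (range (\<lambda>(\<theta>, r). g \<theta> r))"
    and f [measurable]: "f \<in> borel_measurable borel" "\<And>r. 0 \<le> f r" "\<And>r. r < 0 \<Longrightarrow> f r = 0"
    and "prob_space (density lborel (\<lambda>r. ennreal (f r)))"
  shows "(\<integral>(\<theta>, r). g \<theta> r \<partial>(uniform_measure lborel {0..2 * pi} \<Otimes>\<^sub>M density lborel (\<lambda>r. ennreal (f r)))) =
    (1 / (2 * pi)) *\<^sub>R (LBINT r:{0..}. f r *\<^sub>R (LBINT \<theta>:{0..2 * pi}. g \<theta> r))"
proof -
  let ?U = "uniform_measure lborel {0..2 * pi}"
  let ?R = "density lborel (\<lambda>r. ennreal (f r))"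
  interpret U: prob_space ?U
    by (rule prob_space_uniform_circle)
  interpret R: prob_space ?R
    by fact
  interpret pair_prob_space ?U ?R ..
  obtain K where K: "\<And>\<theta> r. norm (g \<theta> r) \<le> K"
    using assms(2) by (auto simp: bounded_iff)
  have U: "(\<integral>\<theta>. g \<theta> r \<partial>?U) = (1 / (2 * pi)) *\<^sub>R (LBINT \<theta>:{0..2 * pi}. g \<theta> r)" for r
  proof -
    have "?U = density lborel (\<lambda>\<theta>. ennreal (1 / (2 * pi) * indicator {0..2 * pi} \<theta>))"
      unfolding uniform_measure_def
      by (intro density_cong) (auto simp: divide_ennreal simp flip: ennreal_1 split: split_indicator)
    then have "(\<integral>\<theta>. g \<theta> r \<partial>?U) = (\<integral>\<theta>. (1 / (2 * pi) * indicator {0..2 * pi} \<theta>) *\<^sub>R g \<theta> r \<partial>lborel)"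
      by (simp only:) (rule integral_density, auto)
    then show ?thesis
      by (simp add: set_lebesgue_integral_def flip: integral_scaleR_right)
  qed
  have "integrable (?U \<Otimes>\<^sub>M ?R) (\<lambda>(\<theta>, r). g \<theta> r)"
    by (rule P.integrable_const_bound[where B = K]) (use K in \<open>auto simp: split_beta\<close>)
  then have "(\<integral>(\<theta>, r). g \<theta> r \<partial>(?U \<Otimes>\<^sub>M ?R)) = (\<integral>r. (\<integral>\<theta>. g \<theta> r \<partial>?U) \<partial>?R)"
    by (subst integral_snd) (simp_all add: split_beta)
  also have "\<dots> = (\<integral>r. f r *\<^sub>R (\<integral>\<theta>. g \<theta> r \<partial>?U) \<partial>lborel)"
    by (rule integral_density) (auto simp: f)
  also have "\<dots> = (\<integral>r. (1 / (2 * pi)) *\<^sub>R (indicator {0..} r *\<^sub>R f r *\<^sub>R (LBINT \<theta>:{0..2 * pi}. g \<theta> r)) \<partial>lborel)"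
    unfolding U by (intro Bochner_Integration.integral_cong) (auto simp: f(3) split: split_indicator)
  finally show ?thesis
    by (simp only: set_lebesgue_integral_def integral_scaleR_right)
qed

theorem proposition3:
  fixes n :: nat and \<phi> :: "real \<Rightarrow> real"
    and M :: "'w measure" and Z :: "nat \<Rightarrow> 'w \<Rightarrow> complex"
  assumes "n \<ge> 1"
    and "\<phi> \<in> borel_measurable (restrict_space borel {0..})"
    and "\<And>y. 0 \<le> y \<Longrightarrow> 0 \<le> \<phi> y"
    and "\<And>j. 1 \<le> j \<Longrightarrow> j \<le> n \<Longrightarrow> 0 < radial_moment \<phi> j \<and> radial_moment \<phi> j < \<infinity>"
    and "prob_space M"
    and "\<exists>c>0. distributed M (\<Pi>\<^sub>M j\<in>{1..n}. (lborel :: complex measure))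
           (\<lambda>\<omega>. \<lambda>j\<in>{1..n}. Z j \<omega>) (\<lambda>z. ennreal (c * rot_inv_weight n \<phi> z))"
  shows
    "(\<forall>h :: complex \<Rightarrow> complex. h \<in> borel_measurable borel \<longrightarrow> bounded (range h) \<longrightarrow>
        (LINT \<omega>|M. h (Z 1 \<omega>)) =
          (1 / (2 * pi)) *\<^sub>R (LBINT r:{0..}.
            mean_radial_density n \<phi> r *\<^sub>R (LBINT \<theta>:{0..2 * pi}. h (of_real r * exp (\<i> * of_real \<theta>)))))
     \<and> distributed M lborel (\<lambda>\<omega>. cmod (Z 1 \<omega>)) (\<lambda>r. ennreal (mean_radial_density n \<phi> r))
     \<and> distr M borel (\<lambda>\<omega>. Arg2pi (Z 1 \<omega>)) = uniform_measure lborel {0..2 * pi}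
     \<and> prob_space.indep_var M borel (\<lambda>\<omega>. Arg2pi (Z 1 \<omega>)) borel (\<lambda>\<omega>. cmod (Z 1 \<omega>))
     \<and> (\<forall>g :: real \<Rightarrow> real \<Rightarrow> complex.
          (\<lambda>(\<theta>, r). g \<theta> r) \<in> borel_measurable (borel \<Otimes>\<^sub>M borel) \<longrightarrow>
          bounded (range (\<lambda>(\<theta>, r). g \<theta> r)) \<longrightarrow>
          (LINT \<omega>|M. g (Arg2pi (Z 1 \<omega>)) (cmod (Z 1 \<omega>))) =
            (1 / (2 * pi)) *\<^sub>R (LBINT r:{0..}.
              mean_radial_density n \<phi> r *\<^sub>R (LBINT \<theta>:{0..2 * pi}. g \<theta> r)))"
proof -
  \<comment> \<open>The hypotheses describe \<open>\<phi>\<close> only on the nonnegative reals.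
    Cutting it to zero elsewhere makes it Borel and nonnegative on the whole line, while weight,
    moments and densities see it only at nonnegative arguments.\<close>
  define f where "f = (\<lambda>r. \<phi> r * indicator {0..} r)"
  have f [measurable]: "f \<in> borel_measurable borel" and f_nonneg: "0 \<le> f r" for r
    using assms(2,3) by (auto simp: f_def borel_measurable_restrict_space_iff mult.commute split: split_indicator)
  have f_eq: "f r = \<phi> r" if "0 \<le> r" for r
    using that by (simp add: f_def)
  have weight: "rot_inv_weight n \<phi> = rot_inv_weight n f"
    by (simp add: rot_inv_weight_def fun_eq_iff f_eq)
  have moment: "radial_moment \<phi> j = radial_moment f j" for j
    unfolding radial_moment_def by (intro nn_integral_cong) (auto simp: f_eq split: split_indicator)
  have mean: "mean_radial_density n \<phi> = mean_radial_density n f"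
    by (auto simp: mean_radial_density_def radial_density_def fun_eq_iff moment f_eq intro!: sum.cong
        split: split_indicator)
  define P where "P = mean_radial_density n f"
  have P [measurable]: "P \<in> borel_measurable borel" and P_nonneg: "0 \<le> P r" for r
    using measurable_radial_density[OF f f_nonneg] radial_density_nonneg[OF f f_nonneg]
    by (auto simp: P_def mean_radial_density_def[abs_def] intro!: sum_nonneg divide_nonneg_nonneg)
  have P_neg: "P r = 0" if "r < 0" for r
    using that by (simp add: P_def mean_radial_density_def radial_density_def)
  let ?U = "uniform_measure lborel {0..2 * pi}"
  let ?R = "density lborel (\<lambda>r. ennreal (P r))"
  interpret prob_space M
    by fact
  obtain c where c: "c > 0" "distributed M (\<Pi>\<^sub>M j\<in>{1..n}. (lborel :: complex measure))
      (\<lambda>\<omega>. \<lambda>j\<in>{1..n}. Z j \<omega>) (\<lambda>z. ennreal (c * rot_inv_weight n f z))"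
    using assms(6) unfolding weight by blast
  note law = distr_Arg2pi_cmod_eq[OF f f_nonneg assms(4)[unfolded moment] assms(1,5) c, folded P_def]
  have Z1 [measurable]: "Z 1 \<in> borel_measurable M" and R: "prob_space ?R"
    and joint: "distr M (borel \<Otimes>\<^sub>M borel) (\<lambda>\<omega>. (Arg2pi (Z 1 \<omega>), cmod (Z 1 \<omega>))) = ?U \<Otimes>\<^sub>M ?R"
    using law by auto
  note [measurable] = Z1[unfolded One_nat_def]
  interpret U: prob_space ?U
    by (rule prob_space_uniform_circle)
  interpret R: prob_space ?R
    by fact
  interpret UR: pair_prob_space ?U ?R ..
  have "distr M borel (\<lambda>\<omega>. Arg2pi (Z 1 \<omega>)) = distr (?U \<Otimes>\<^sub>M ?R) borel fst"
    unfolding joint[symmetric] by (subst distr_distr) (auto simp: o_def)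
  also have "\<dots> = distr (?U \<Otimes>\<^sub>M ?R) ?U fst"
    by (rule distr_cong) auto
  finally have Arg: "distr M borel (\<lambda>\<omega>. Arg2pi (Z 1 \<omega>)) = ?U"
    using R.distr_pair_fst by simp
  \<comment> \<open>The target \<open>N\<close> is left open because independence is phrased with
    \<open>borel\<close> and the density statement with \<open>lborel\<close>.\<close>
  have cmod: "distr M N (\<lambda>\<omega>. cmod (Z 1 \<omega>)) = ?R" if [measurable_cong]: "sets N = sets borel" for N
  proof (rule measure_eqI)
    fix A assume "A \<in> sets (distr M N (\<lambda>\<omega>. cmod (Z 1 \<omega>)))"
    then have [measurable]: "A \<in> sets borel"
      using that by simp
    have "emeasure (distr M N (\<lambda>\<omega>. cmod (Z 1 \<omega>))) A =
        emeasure (distr M (borel \<Otimes>\<^sub>M borel) (\<lambda>\<omega>. (Arg2pi (Z 1 \<omega>), cmod (Z 1 \<omega>)))) (UNIV \<times> A)"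
      using that by (simp add: emeasure_distr vimage_def)
    also have "\<dots> = emeasure ?U UNIV * emeasure ?R A"
      unfolding joint by (rule R.emeasure_pair_measure_Times) auto
    finally show "emeasure (distr M N (\<lambda>\<omega>. cmod (Z 1 \<omega>))) A = emeasure ?R A"
      using U.emeasure_space_1 by simp
  qed (simp add: that)
  have indep: "indep_var borel (\<lambda>\<omega>. Arg2pi (Z 1 \<omega>)) borel (\<lambda>\<omega>. cmod (Z 1 \<omega>))"
    unfolding indep_var_distribution_eq using joint Arg cmod[of borel] by simp
  have g: "(LINT \<omega>|M. g (Arg2pi (Z 1 \<omega>)) (cmod (Z 1 \<omega>))) =
      (1 / (2 * pi)) *\<^sub>R (LBINT r:{0..}. P r *\<^sub>R (LBINT \<theta>:{0..2 * pi}. g \<theta> r))"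
    if [measurable]: "(\<lambda>(\<theta>, r). g \<theta> r) \<in> borel_measurable (borel \<Otimes>\<^sub>M borel)"
      and "bounded (range (\<lambda>(\<theta>, r). g \<theta> r))" for g :: "real \<Rightarrow> real \<Rightarrow> complex"
  proof -
    have "(LINT \<omega>|M. g (Arg2pi (Z 1 \<omega>)) (cmod (Z 1 \<omega>))) =
        (\<integral>(\<theta>, r). g \<theta> r \<partial>distr M (borel \<Otimes>\<^sub>M borel) (\<lambda>\<omega>. (Arg2pi (Z 1 \<omega>), cmod (Z 1 \<omega>))))"
      by (subst integral_distr) auto
    then show ?thesis
      unfolding joint using integral_uniform_pair[OF that P P_nonneg P_neg R] by simp
  qed
  have h: "(LINT \<omega>|M. h (Z 1 \<omega>)) =
      (1 / (2 * pi)) *\<^sub>R (LBINT r:{0..}. P r *\<^sub>R (LBINT \<theta>:{0..2 * pi}. h (of_real r * exp (\<i> * of_real \<theta>))))"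
    if [measurable]: "h \<in> borel_measurable borel" and "bounded (range h)" for h :: "complex \<Rightarrow> complex"
  proof -
    \<comment> \<open>The formula for \<open>g\<close> is applied to \<open>h\<close> in polar form;
      modulus and argument together recover \<open>Z 1\<close>, so this is again the expectation of
      \<open>h (Z 1)\<close>.\<close>
    have "(\<lambda>(\<theta>, r). h (of_real r * exp (\<i> * of_real \<theta>))) \<in> borel_measurable (borel \<Otimes>\<^sub>M borel)"
      by (simp add: split_beta flip: cis_conv_exp)
    moreover have "bounded (range (\<lambda>(\<theta>, r). h (of_real r * exp (\<i> * of_real \<theta>))))"
      by (rule bounded_subset[OF that(2)]) auto
    ultimately have "(LINT \<omega>|M. h (of_real (cmod (Z 1 \<omega>)) * exp (\<i> * of_real (Arg2pi (Z 1 \<omega>))))) =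
      (1 / (2 * pi)) *\<^sub>R (LBINT r:{0..}. P r *\<^sub>R (LBINT \<theta>:{0..2 * pi}. h (of_real r * exp (\<i> * of_real \<theta>))))"
      by (rule g)
    then show ?thesis
      by (simp flip: Arg2pi_eq)
  qed
  show ?thesis
    unfolding mean P_def[symmetric] using h Arg indep g cmod[of lborel]
    by (auto simp: distributed_def)
qed

end
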